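(* Let $M$ be a matroid of finite rank on ground set $E$, and let $\mathbf Z,\mathbf B$ be two filtrations on $M$ by closed sets such that $\mathbf B_p\subseteq\mathbf Z_p$ for all $p\in\mathbb Z$. Let $N$ and $T:N\to N$ be the associated matroid and map. Then the Jordan bases of $T$ are exactly the orbits in $N$ of the $\mathbf Z$-$\mathbf B$-minimal bases of $M$.
   Context: A filtration on $M$ is given by a function $\mathbf F:E\to\{1,\dots,n\}$, with $\mathbf F_p=\{e\in E:\mathbf F(e)\le p\}$ for $p\in\mathbb Z$ (so $\mathbf F_p=\emptyset$ for $p\le 0$ and $\mathbf F_p=E$ for $p\ge n$); it is a filtration by closed sets if $\mathbf F_1,\dots,\mathbf F_n$ are flats of $M$. For each $p$ let $H_p$ be the matroid on ground set $\mathbf Z_p$ in which a set $I$ is independent iff $I\cup J$ is independent in $M$ and $I\cap J=\emptyset$ for a (equivalently every) basis $J$ of $\mathbf B_p$; in particular elements of $\mathbf B_p$ are loops of $H_p$. Let $N$ be the direct sum (matroid union on disjoint ground sets) of all $H_p$, $p\in\mathbb Z$, and write $e^{(p)}$ for the copy of $e\in\mathbf Z_p$ in $H_p$. Let $T$ be the map $T(e^{(p)})=e^{(p+1)}$. The orbit of an element $x$ of $N$ is the set of all non-loops of the form $T^m x$, $m\ge0$. A Jordan basis of $T$ is a basis of $N$ that is a disjoint union of orbits of elements. The orbit in $N$ of a subset $S\subseteq E$ is the union over $e\in S$ of the orbits of $e^{(\mathbf Z(e))}$. For a function $\mathbf F:E\to\mathbb Z$, a basis $C$ of $M$ is $\mathbf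 F$-minimal if $\sum_{c\in C}\mathbf F(c)$ is minimal among bases of $M$. A basis is $\mathbf Z$-$\mathbf B$-minimal if it is both $\mathbf Z$-minimal and $\mathbf B$-minimal. *)

theory Defs
  imports Main "HOL-Library.Disjoint_Sets"
begin

section \<open>Matroids of finite rank\<close>

text \<open>The ground set may be infinite; finite rank is the existence of a common bound
  on the cardinalities of the independent sets.\<close>

locale finite_rank_matroid =
  fixes E :: "'a set" and indep :: "'a set \<Rightarrow> bool"
  assumes indep_subset_carrier: "indep I \<Longrightarrow> I \<subseteq> E"
    and indep_empty: "indep {}"
    and indep_subset: "indep J \<Longrightarrow> I \<subseteq> J \<Longrightarrow> indep I"
    and augment: "indep I \<Longrightarrow> indep J \<Longrightarrow> card I < card J \<Longrightarrow> \<exists>x\<in>J - I. indep (insert x I)"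
    and finite_rank: "\<exists>r. \<forall>I. indep I \<longrightarrow> finite I \<and> card I \<le> r"

definition basis_in :: "('a set \<Rightarrow> bool) \<Rightarrow> 'a set \<Rightarrow> 'a set \<Rightarrow> bool" where
  "basis_in indep X J \<longleftrightarrow>
     J \<subseteq> X \<and> indep J \<and> (\<forall>I. J \<subseteq> I \<and> I \<subseteq> X \<and> indep I \<longrightarrow> I = J)"

text \<open>The maximum exists in a matroid of finite rank, also when \<open>X\<close> is infinite.\<close>

definition rank :: "('a set \<Rightarrow> bool) \<Rightarrow> 'a set \<Rightarrow> nat" where
  "rank indep X = Max (card ` {I. I \<subseteq> X \<and> indep I})"

definition cl :: "'a set \<Rightarrow> ('a set \<Rightarrow> bool) \<Rightarrow> 'a set \<Rightarrow> 'a set" where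
  "cl E indep X = {e \<in> E. rank indep (insert e X) = rank indep X}"

definition flat :: "'a set \<Rightarrow> ('a set \<Rightarrow> bool) \<Rightarrow> 'a set \<Rightarrow> bool" where
  "flat E indep X \<longleftrightarrow> X \<subseteq> E \<and> cl E indep X = X"

definition loop :: "'a set \<Rightarrow> ('a set \<Rightarrow> bool) \<Rightarrow> 'a \<Rightarrow> bool" where
  "loop E indep x \<longleftrightarrow> x \<in> E \<and> \<not> indep {x}"

definition minimal_basis :: "'a set \<Rightarrow> ('a set \<Rightarrow> bool) \<Rightarrow> ('a \<Rightarrow> int) \<Rightarrow> 'a set \<Rightarrow> bool" where
  "minimal_basis E indep F C \<longleftrightarrow>
     basis_in indep E C \<and> (\<forall>D. basis_in indep E D \<longrightarrow> sum F C \<le> sum F D)"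


section \<open>Filtrations\<close>

text \<open>Only the values of \<open>F\<close> on the ground set matter.\<close>

definition level :: "'a set \<Rightarrow> ('a \<Rightarrow> int) \<Rightarrow> int \<Rightarrow> 'a set" where
  "level E F p = {e \<in> E. F e \<le> p}"

definition closed_filtration ::
    "'a set \<Rightarrow> ('a set \<Rightarrow> bool) \<Rightarrow> nat \<Rightarrow> ('a \<Rightarrow> int) \<Rightarrow> bool" where
  "closed_filtration E indep n F \<longleftrightarrow>
     F ` E \<subseteq> {1..int n} \<and> (\<forall>p\<in>{1..int n}. flat E indep (level E F p))"


section \<open>The matroid \<open>N\<close> and the map \<open>T\<close>\<close>

text \<open>The matroid \<open>H\<^sub>p\<close> has ground set \<open>level E Z p\<close>. In a matroid the condition below
  does not depend on the choice of the basis \<open>J\<close>.\<close>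

definition H_indep ::
    "'a set \<Rightarrow> ('a set \<Rightarrow> bool) \<Rightarrow> ('a \<Rightarrow> int) \<Rightarrow> ('a \<Rightarrow> int) \<Rightarrow> int \<Rightarrow> 'a set \<Rightarrow> bool" where
  "H_indep E indep Z B p I \<longleftrightarrow>
     I \<subseteq> level E Z p \<and>
     (\<exists>J. basis_in indep (level E B p) J \<and> indep (I \<union> J) \<and> I \<inter> J = {})"

text \<open>The pair \<open>(e, p)\<close> stands for the copy \<open>e\<^sup>(\<^sup>p\<^sup>)\<close> of \<open>e\<close> in \<open>H\<^sub>p\<close>.\<close>

definition N_carrier :: "'a set \<Rightarrow> ('a \<Rightarrow> int) \<Rightarrow> ('a \<times> int) set" where
  "N_carrier E Z = {(e, p). e \<in> level E Z p}"

definition N_indep ::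
    "'a set \<Rightarrow> ('a set \<Rightarrow> bool) \<Rightarrow> ('a \<Rightarrow> int) \<Rightarrow> ('a \<Rightarrow> int) \<Rightarrow> ('a \<times> int) set \<Rightarrow> bool" where
  "N_indep E indep Z B I \<longleftrightarrow>
     I \<subseteq> N_carrier E Z \<and> (\<forall>p. H_indep E indep Z B p {e. (e, p) \<in> I})"

definition T :: "'a \<times> int \<Rightarrow> 'a \<times> int" where
  "T x = (fst x, snd x + 1)"


section \<open>Orbits and Jordan bases\<close>

definition orbit :: "'b set \<Rightarrow> ('b set \<Rightarrow> bool) \<Rightarrow> ('b \<Rightarrow> 'b) \<Rightarrow> 'b \<Rightarrow> 'b set" where
  "orbit E indep f x = {y \<in> E. (\<exists>m. y = (f ^^ m) x) \<and> \<not> loop E indep y}"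

definition jordan_basis :: "'b set \<Rightarrow> ('b set \<Rightarrow> bool) \<Rightarrow> ('b \<Rightarrow> 'b) \<Rightarrow> 'b set \<Rightarrow> bool" where
  "jordan_basis E indep f J \<longleftrightarrow>
     basis_in indep E J \<and>
     (\<exists>X \<subseteq> E. disjoint_family_on (orbit E indep f) X \<and> J = (\<Union>x\<in>X. orbit E indep f x))"

definition orbit_in_N ::
    "'a set \<Rightarrow> ('a set \<Rightarrow> bool) \<Rightarrow> ('a \<Rightarrow> int) \<Rightarrow> ('a \<Rightarrow> int) \<Rightarrow> 'a set \<Rightarrow> ('a \<times> int) set" where
  "orbit_in_N E indep Z B S =
     (\<Union>e\<in>S. orbit (N_carrier E Z) (N_indep E indep Z B) T (e, Z e))"

end

theory Submission
  imports Defs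
begin

text \<open>A basis \<open>C\<close> of \<open>M\<close> is \<open>F\<close>-minimal iff \<open>C \<inter> F\<^sub>p\<close> is a basis of \<open>F\<^sub>p\<close> for every \<open>p\<close>, and
  since the \<open>B\<^sub>p\<close> are flats, \<open>e\<^sup>(\<^sup>p\<^sup>)\<close> is a non-loop of \<open>N\<close> iff \<open>Z e \<le> p < B e\<close>. So the fibre over
  \<open>p\<close> of the orbit of a minimal basis \<open>C\<close> is \<open>C \<inter> Z\<^sub>p - C \<inter> B\<^sub>p\<close>, a basis of \<open>H\<^sub>p\<close>.
  Conversely, the fibres \<open>S\<^sub>p\<close> of a Jordan basis satisfy \<open>S\<^sub>p - B\<^sub>p\<^sub>+\<^sub>1 \<subseteq> S\<^sub>p\<^sub>+\<^sub>1\<close>. Choose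
  inductively bases \<open>C\<^sub>p\<close> of \<open>B\<^sub>p\<close> with \<open>C\<^sub>p \<union> (S\<^sub>p \<inter> B\<^sub>p\<^sub>+\<^sub>1) \<subseteq> C\<^sub>p\<^sub>+\<^sub>1\<close>, which is possible because
  \<open>S\<^sub>p\<close> is independent over \<open>B\<^sub>p\<close>. Their union \<open>C\<close> contains every \<open>S\<^sub>p\<close>, and \<open>C\<^sub>p \<union> S\<^sub>p\<close> is a
  basis of \<open>Z\<^sub>p\<close>, hence equal to \<open>C \<inter> Z\<^sub>p\<close>. Thus \<open>C\<close> is minimal for both filtrations and
  \<open>S\<^sub>p = C \<inter> Z\<^sub>p - B\<^sub>p\<close>.\<close>

section \<open>Bases in matroids of finite rank\<close>

lemma basis_inD:
  assumes "basis_in indep X J"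
  shows "J \<subseteq> X" "indep J" "\<And>I. J \<subseteq> I \<Longrightarrow> I \<subseteq> X \<Longrightarrow> indep I \<Longrightarrow> I = J"
  using assms unfolding basis_in_def by blast+

context finite_rank_matroid
begin

lemma indep_finite: "indep I \<Longrightarrow> finite I"
  using finite_rank by blast

text \<open>The rank bound yields an independent set between \<open>I\<close> and \<open>X\<close>
  of greatest cardinality, even for infinite \<open>X\<close>; being finite, it is also maximal
  under inclusion.\<close>

lemma indep_extend_basis:
  assumes "indep I" "I \<subseteq> X"
  obtains J where "I \<subseteq> J" "basis_in indep X J"
proof -
  obtain r where r: "\<And>K. indep K \<Longrightarrow> card K \<le> r"
    using finite_rank by blast
  let ?P = "\<lambda>K. I \<subseteq> K \<and> K \<subseteq> X \<and> indep K"
  obtain J where J: "?P J" and max: "\<And>K. ?P K \<Longrightarrow> card K \<le> card J"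
    using ex_has_greatest_nat[of ?P I card "Suc r"] assms r by (auto simp: less_Suc_eq_le)
  have "K = J" if "J \<subseteq> K" "K \<subseteq> X" "indep K" for K
    using card_seteq[of K J] max[of K] that J indep_finite by blast
  then have "basis_in indep X J"
    using J unfolding basis_in_def by blast
  then show ?thesis using that J by blast
qed

lemma basis_exists: obtains J where "basis_in indep X J"
  using indep_extend_basis[OF indep_empty] by blast

lemma indep_card_le_basis:
  assumes "basis_in indep X J" "indep I" "I \<subseteq> X"
  shows "card I \<le> card J"
proof (rule ccontr)
  assume "\<not> card I \<le> card J"
  then obtain x where "x \<in> I - J" "indep (insert x J)"
    using augment[of J I] assms basis_inD(2) by fastforce
  then show False
    using basis_inD[OF assms(1)] assms(3) by blast
qed

lemma basis_inI_card:
  assumes "basis_in indep X K" "J \<subseteq> X" "indep J" "card K \<le> card J"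
  shows "basis_in indep X J"
  unfolding basis_in_def
proof (intro conjI allI impI)
  fix I assume I: "J \<subseteq> I \<and> I \<subseteq> X \<and> indep I"
  then have "card I \<le> card J"
    using indep_card_le_basis[OF assms(1)] assms(4) by fastforce
  then show "I = J"
    using card_seteq[of I J] I indep_finite by blast
qed (use assms in auto)

lemma basis_card_eq:
  "basis_in indep X J \<Longrightarrow> basis_in indep X K \<Longrightarrow> card J = card K"
  by (meson basis_inD indep_card_le_basis le_antisym)

lemma rank_eq_card:
  assumes "basis_in indep X J"
  shows "rank indep X = card J"
  unfolding rank_def
proof (rule Max_eqI)
  show "finite (card ` {I. I \<subseteq> X \<and> indep I})"
    by (rule finite_subset[of _ "{..card J}"]) (use assms indep_card_le_basis in auto)
  show "card J \<in> card ` {I. I \<subseteq> X \<and> indep I}"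
    using basis_inD(1,2)[OF assms] by blast
qed (use assms indep_card_le_basis in auto)

text \<open>Otherwise \<open>J\<close> would remain a basis of \<open>insert e X\<close>, so
  \<open>e\<close> would not raise the rank and would lie in the closure of
  \<open>X\<close>.\<close>

lemma indep_insert_flat:
  assumes "flat E indep X" "e \<in> E" "e \<notin> X" "basis_in indep X J"
  shows "indep (insert e J)"
proof (rule ccontr)
  assume dep: "\<not> indep (insert e J)"
  have "basis_in indep (insert e X) J"
    unfolding basis_in_def
  proof (intro conjI allI impI)
    fix I assume I: "J \<subseteq> I \<and> I \<subseteq> insert e X \<and> indep I"
    then have "e \<notin> I" using dep indep_subset[of I "insert e J"] by blast
    then show "I = J" using I basis_inD(3)[OF assms(4)] by blast
  qed (use basis_inD[OF assms(4)] in auto)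
  then have "e \<in> cl E indep X"
    using assms rank_eq_card unfolding cl_def by auto
  then show False using assms unfolding flat_def by blast
qed

text \<open>Makes the choice of \<open>J\<close> in \<open>H_indep\<close> immaterial. A basis
  \<open>K\<close> of \<open>I \<union> J'\<close> containing \<open>J'\<close> cannot be augmented
  from \<open>I \<union> J\<close>, so it has at least \<open>card I + card J'\<close> elements;
  this leaves room neither for overlap nor for a missing element.\<close>

lemma indep_over_basis_cong:
  assumes J: "basis_in indep X J" and J': "basis_in indep X J'"
    and ind: "indep (I \<union> J)" and disj: "I \<inter> J = {}"
  shows "indep (I \<union> J')" "I \<inter> J' = {}"
proof -
  obtain K where K: "J' \<subseteq> K" "basis_in indep (I \<union> J') K"
    using indep_extend_basis[of J' "I \<union> J'"] basis_inD(2)[OF J'] by blast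
  note KD = basis_inD[OF K(2)]
  have fin: "finite I" "finite J" "finite J'"
    using indep_finite[OF ind] indep_finite[OF basis_inD(2)[OF J']] by auto
  have "\<not> card K < card (I \<union> J)"
  proof
    assume "card K < card (I \<union> J)"
    then obtain x where x: "x \<in> (I \<union> J) - K" "indep (insert x K)"
      using augment[OF KD(2) ind] by blast
    show False
    proof (cases "x \<in> I")
      case True
      then show False using KD(1) KD(3)[of "insert x K"] x by blast
    next
      case False
      have "indep (insert x J')" using indep_subset[OF x(2)] K(1) by blast
      then have "insert x J' = J'"
        using False x basis_inD(1)[OF J] basis_inD(1)[OF J']
        by (intro basis_inD(3)[OF J']) auto
      then show False using x K by blast
    qed
  qed
  then have "card I + card J' \<le> card K"
    using card_Un_disjoint[OF fin(1,2) disj] basis_card_eq[OF J J'] by simp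
  moreover have "card (I \<union> J') + card (I \<inter> J') = card I + card J'"
    using card_Un_Int[OF fin(1,3)] by simp
  moreover have "card K \<le> card (I \<union> J')"
    using KD(1) fin by (intro card_mono) auto
  ultimately have "card (I \<inter> J') = 0" "card (I \<union> J') \<le> card K"
    by linarith+
  then show "I \<inter> J' = {}" "indep (I \<union> J')"
    using card_seteq[OF _ KD(1)] KD(2) fin by auto
qed

section \<open>Minimal bases\<close>

text \<open>Summation by parts: \<open>n - F c\<close> counts the \<open>p\<close> with
  \<open>F c \<le> p < n\<close>. Minimising the sum over bases thus becomes maximising the traces
  on the levels.\<close>

lemma sum_eq_sum_card_levels:
  fixes F :: "'b \<Rightarrow> int"
  assumes "finite C" "F ` C \<subseteq> {1..int n}"
  shows "sum F C = int n * int (card C) - (\<Sum>p\<in>{1..<int n}. int (card {c \<in> C. F c \<le> p}))"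
proof -
  have "F c = int n - (\<Sum>p\<in>{1..<int n}. if F c \<le> p then 1 else 0)" if "c \<in> C" for c
  proof -
    have "{1..<int n} \<inter> {p. F c \<le> p} = {F c..<int n}" "F c \<le> int n"
      using assms that by force+
    then show ?thesis by (simp add: sum.If_cases)
  qed
  then have "sum F C = (\<Sum>c\<in>C. int n - (\<Sum>p\<in>{1..<int n}. if F c \<le> p then 1 else 0))"
    by (rule sum.cong[OF refl])
  also have "\<dots> = int n * int (card C) - (\<Sum>c\<in>C. \<Sum>p\<in>{1..<int n}. if F c \<le> p then 1 else 0)"
    by (simp add: sum_subtractf)
  also have "(\<Sum>c\<in>C. \<Sum>p\<in>{1..<int n}. if F c \<le> p then 1 else 0)
      = (\<Sum>p\<in>{1..<int n}. \<Sum>c\<in>C. if F c \<le> p then 1 else (0::int))"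
    by (rule sum.swap)
  also have "\<dots> = (\<Sum>p\<in>{1..<int n}. int (card {c \<in> C. F c \<le> p}))"
    using assms(1) by (intro sum.cong refl) (simp add: sum.If_cases Int_def)
  finally show ?thesis .
qed

text \<open>Exchange argument: if the trace on a level could be enlarged by \<open>e\<close>,
  swapping \<open>e\<close> for some element of \<open>C\<close> outside the level would lower the
  sum.\<close>

lemma level_basis_if_minimal_basis:
  assumes min: "minimal_basis E indep F C"
  shows "basis_in indep (level E F p) (C \<inter> level E F p)"
proof (rule ccontr)
  let ?L = "level E F p"
  have bC: "basis_in indep E C"
    and least: "\<And>D. basis_in indep E D \<Longrightarrow> sum F C \<le> sum F D"
    using min unfolding minimal_basis_def by auto
  note CD = basis_inD[OF bC]
  have fC: "finite C" using CD indep_finite by blast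
  have iCL: "indep (C \<inter> ?L)" using indep_subset[OF CD(2)] by blast
  assume "\<not> basis_in indep ?L (C \<inter> ?L)"
  then obtain I where I: "C \<inter> ?L \<subseteq> I" "I \<subseteq> ?L" "indep I" "I \<noteq> C \<inter> ?L"
    using iCL unfolding basis_in_def by auto
  then obtain e where e: "e \<in> I" "e \<notin> C \<inter> ?L" by blast
  then have eL: "e \<in> ?L" "e \<notin> C" using I by auto
  have "indep (insert e (C \<inter> ?L))"
    using indep_subset[OF I(3)] I(1) e(1) by blast
  \<comment> \<open>Keeping all of \<open>C \<inter> ?L\<close> in \<open>D\<close> forces the
    element that \<open>e\<close> replaces to lie outside the level.\<close>
  then obtain D where D: "insert e (C \<inter> ?L) \<subseteq> D" "basis_in indep (insert e C) D"
    using indep_extend_basis[of "insert e (C \<inter> ?L)" "insert e C"] by blast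
  note DD = basis_inD[OF D(2)]
  have "card C \<le> card D"
    using indep_card_le_basis[OF D(2) CD(2)] by blast
  moreover have DE: "D \<subseteq> E"
    using DD(1) CD(1) eL unfolding level_def by blast
  ultimately have bD: "basis_in indep E D"
    using basis_inI_card[OF bC] DD by blast
  have "card (C - D) = card (D - C)"
    using basis_card_eq[OF bC bD] fC indep_finite[OF DD(2)]
    by (simp add: card_Diff_subset_Int Int_commute)
  moreover have "D - C = {e}" using DD(1) D(1) eL by blast
  ultimately obtain c where c: "C - D = {c}"
    by (metis card_1_singletonE card.empty card_insert_disjoint empty_iff finite.emptyI One_nat_def)
  have cC: "c \<in> C" using c by blast
  have "c \<notin> ?L" using c D(1) by blast
  then have less: "F e < F c"
    using eL cC CD(1) unfolding level_def by auto
  have "D = insert e (C - {c})" using c \<open>D - C = {e}\<close> by blast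
  then have "sum F D = F e + sum F (C - {c})" using fC eL by simp
  moreover have "sum F C = F c + sum F (C - {c})"
    using fC cC by (simp add: sum.remove)
  ultimately show False using least[OF bD] less by linarith
qed

text \<open>The trace of any basis \<open>D\<close> on a level is independent, hence no larger than
  that of \<open>C\<close>; the summation formula compares the sums.\<close>

lemma minimal_basis_if_level_basis:
  assumes F: "F ` E \<subseteq> {1..int n}" and bC: "basis_in indep E C"
    and lev: "\<And>p. basis_in indep (level E F p) (C \<inter> level E F p)"
  shows "minimal_basis E indep F C"
  unfolding minimal_basis_def
proof (intro conjI allI impI bC)
  fix D assume bD: "basis_in indep E D"
  have CE: "C \<subseteq> E" "finite C" and DE: "D \<subseteq> E" "finite D"
    using basis_inD(1,2)[OF bC] basis_inD(1,2)[OF bD] indep_finite by auto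
  have "card {d \<in> D. F d \<le> p} \<le> card {c \<in> C. F c \<le> p}" for p
  proof -
    have "indep {d \<in> D. F d \<le> p}"
      by (rule indep_subset[OF basis_inD(2)[OF bD]]) blast
    moreover have "C \<inter> level E F p = {c \<in> C. F c \<le> p}"
      using CE unfolding level_def by blast
    ultimately show ?thesis
      using indep_card_le_basis[OF lev[of p], of "{d \<in> D. F d \<le> p}"] DE(1)
      unfolding level_def by auto
  qed
  then have "(\<Sum>p\<in>{1..<int n}. int (card {d \<in> D. F d \<le> p}))
      \<le> (\<Sum>p\<in>{1..<int n}. int (card {c \<in> C. F c \<le> p}))"
    by (intro sum_mono) simp
  moreover have "F ` C \<subseteq> {1..int n}" "F ` D \<subseteq> {1..int n}"
    using F CE(1) DE(1) by blast+
  ultimately show "sum F C \<le> sum F D"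
    using sum_eq_sum_card_levels[of C F n] sum_eq_sum_card_levels[of D F n] CE(2) DE(2)
      basis_card_eq[OF bC bD] by simp
qed

end

section \<open>Fibres and orbits in \<open>N\<close>\<close>

locale closed_filtration_pair = finite_rank_matroid E indep
  for E :: "'a set" and indep :: "'a set \<Rightarrow> bool" +
  fixes Z B :: "'a \<Rightarrow> int" and n m :: nat
  assumes Z: "closed_filtration E indep n Z"
    and B: "closed_filtration E indep m B"
    and level_B_subset: "level E B p \<subseteq> level E Z p"
begin

abbreviation "LZ \<equiv> level E Z"
abbreviation "LB \<equiv> level E B"
abbreviation "H \<equiv> H_indep E indep Z B"
abbreviation "NE \<equiv> N_carrier E Z"
abbreviation "NI \<equiv> N_indep E indep Z B"
abbreviation "fibre I p \<equiv> {e. (e, p) \<in> I}"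

lemma Z_range: "Z ` E \<subseteq> {1..int n}" and B_range: "B ` E \<subseteq> {1..int m}"
  using Z B unfolding closed_filtration_def by auto

lemma LB_eq_carrier: "int m \<le> p \<Longrightarrow> LB p = E"
  using B_range unfolding level_def by force

lemma LB_empty: "p \<le> 0 \<Longrightarrow> LB p = {}"
  using B_range unfolding level_def by force

lemma LB_mono: "p \<le> q \<Longrightarrow> LB p \<subseteq> LB q"
  unfolding level_def by auto

lemma H_iff:
  assumes "basis_in indep (LB p) J"
  shows "H p I \<longleftrightarrow> I \<subseteq> LZ p \<and> indep (I \<union> J) \<and> I \<inter> J = {}"
  unfolding H_indep_def using assms indep_over_basis_cong by blast

lemma H_empty: "H p {}"
proof -
  obtain J where J: "basis_in indep (LB p) J" by (rule basis_exists)
  show ?thesis unfolding H_iff[OF J] using basis_inD[OF J] by simp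
qed

lemma H_disjoint_LB:
  assumes "H p I"
  shows "I \<inter> LB p = {}"
proof -
  obtain J where J: "basis_in indep (LB p) J" by (rule basis_exists)
  have I: "indep (I \<union> J)" "I \<inter> J = {}" using assms H_iff[OF J] by auto
  have "e \<in> J" if "e \<in> I" "e \<in> LB p" for e
  proof -
    have "indep (insert e J)" using indep_subset[OF I(1)] that by blast
    then have "insert e J = J"
      using that basis_inD(1)[OF J] by (intro basis_inD(3)[OF J]) auto
    then show ?thesis by blast
  qed
  then show ?thesis using I by blast
qed

text \<open>Closedness of the levels of \<open>B\<close> enters here: an element outside a flat is
  independent over any basis of it.\<close>

lemma H_singleton_iff:
  assumes "e \<in> LZ p"
  shows "H p {e} \<longleftrightarrow> e \<notin> LB p"
proof
  assume "e \<notin> LB p"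
  \<comment> \<open>Flatness is given only for indices in \<open>{1..int m}\<close>, so
    \<open>p\<close> must first be located there.\<close>
  have "1 \<le> p" using Z_range assms unfolding level_def by force
  moreover have "p < int m"
    using \<open>e \<notin> LB p\<close> assms LB_eq_carrier[of p] unfolding level_def by force
  ultimately have flat: "flat E indep (LB p)"
    using B unfolding closed_filtration_def by simp
  obtain J where J: "basis_in indep (LB p) J" by (rule basis_exists)
  have "indep (insert e J)"
    using indep_insert_flat[OF flat _ \<open>e \<notin> LB p\<close> J] assms unfolding level_def by blast
  then show "H p {e}"
    unfolding H_iff[OF J] using assms \<open>e \<notin> LB p\<close> basis_inD(1)[OF J] by auto
qed (use H_disjoint_LB in auto)

lemma loop_N_iff:
  assumes "(e, p) \<in> NE"
  shows "loop NE NI (e, p) \<longleftrightarrow> e \<in> LB p"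
proof -
  have "fibre {(e, p)} q = (if q = p then {e} else {})" for q by auto
  then have "NI {(e, p)} \<longleftrightarrow> H p {e}"
    using assms H_empty unfolding N_indep_def by auto
  then show ?thesis
    using assms H_singleton_iff unfolding loop_def N_carrier_def by auto
qed

lemma T_funpow: "(T ^^ k) (e, p) = (e, p + int k)"
  by (induction k) (auto simp: T_def)

text \<open>\<open>T\<close> only raises the level, and a copy of \<open>e\<close> becomes a loop
  exactly when the level reaches \<open>B e\<close>.\<close>

lemma orbit_N_iff:
  assumes "(e, p) \<in> NE"
  shows "x \<in> orbit NE NI T (e, p) \<longleftrightarrow> fst x = e \<and> p \<le> snd x \<and> snd x < B e"
proof -
  obtain f q where x: "x = (f, q)" by fastforce
  have "(\<exists>k. q = p + int k) \<longleftrightarrow> p \<le> q"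
    using zle_iff_zadd[of p q] by auto
  then have 1: "(\<exists>k. x = (T ^^ k) (e, p)) \<longleftrightarrow> f = e \<and> p \<le> q"
    unfolding T_funpow x by auto
  have 2: "(e, q) \<in> NE" "e \<in> E" if "p \<le> q"
    using assms that unfolding N_carrier_def level_def by auto
  have "x \<in> orbit NE NI T (e, p) \<longleftrightarrow> x \<in> NE \<and> (f = e \<and> p \<le> q) \<and> \<not> loop NE NI x"
    unfolding orbit_def using 1 by blast
  also have "\<dots> \<longleftrightarrow> f = e \<and> p \<le> q \<and> e \<notin> LB q"
    using 2 loop_N_iff[of e q] x by auto
  also have "\<dots> \<longleftrightarrow> f = e \<and> p \<le> q \<and> q < B e"
    using 2 unfolding level_def by auto
  finally show ?thesis using x by simp
qed

lemma basis_N_iff: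
  "basis_in NI NE J \<longleftrightarrow> J \<subseteq> NE \<and> (\<forall>p. basis_in (H p) (LZ p) (fibre J p))"
proof
  assume J: "basis_in NI NE J"
  note JD = basis_inD[OF J]
  have "basis_in (H p) (LZ p) (fibre J p)" for p
    unfolding basis_in_def
  proof (intro conjI allI impI)
    show "fibre J p \<subseteq> LZ p" using JD(1) unfolding N_carrier_def by auto
    show "H p (fibre J p)" using JD(2) unfolding N_indep_def by blast
    fix I assume I: "fibre J p \<subseteq> I \<and> I \<subseteq> LZ p \<and> H p I"
    \<comment> \<open>Only the fibre over \<open>p\<close> grows, so maximality of \<open>J\<close>
      in \<open>N\<close> tests maximality of that single fibre.\<close>
    let ?K = "J \<union> I \<times> {p}"
    have K: "?K \<subseteq> NE" using JD(1) I unfolding N_carrier_def by auto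
    have "fibre ?K q = (if q = p then I else fibre J q)" for q using I by auto
    then have "NI ?K" using I JD(2) K unfolding N_indep_def by auto
    then have "?K = J" using JD(3) K by blast
    then show "I = fibre J p" using I by blast
  qed
  then show "J \<subseteq> NE \<and> (\<forall>p. basis_in (H p) (LZ p) (fibre J p))" using JD(1) by blast
next
  assume J: "J \<subseteq> NE \<and> (\<forall>p. basis_in (H p) (LZ p) (fibre J p))"
  then have bJ: "\<And>p. basis_in (H p) (LZ p) (fibre J p)" by blast
  show "basis_in NI NE J"
    unfolding basis_in_def
  proof (intro conjI allI impI)
    show "NI J" using J basis_inD(2)[OF bJ] unfolding N_indep_def by blast
    fix I assume I: "J \<subseteq> I \<and> I \<subseteq> NE \<and> NI I"
    have "fibre I p = fibre J p" for p
      using I unfolding N_indep_def N_carrier_def by (intro basis_inD(3)[OF bJ]) auto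
    then show "I = J" by auto
  qed (use J in blast)
qed

text \<open>\<open>H p\<close> is the restriction of the matroid to \<open>LZ p\<close> with
  \<open>LB p\<close> contracted; its bases complete a basis of \<open>LB p\<close> to one of
  \<open>LZ p\<close>.\<close>

lemma basis_H_iff:
  assumes J: "basis_in indep (LB p) J" and disj: "S \<inter> J = {}"
  shows "basis_in (H p) (LZ p) S \<longleftrightarrow> S \<subseteq> LZ p \<and> basis_in indep (LZ p) (S \<union> J)"
proof
  have JZ: "J \<subseteq> LZ p" using basis_inD(1)[OF J] level_B_subset by blast
  {
    assume S: "basis_in (H p) (LZ p) S"
    note SD = basis_inD[OF S]
    have "basis_in indep (LZ p) (S \<union> J)"
      unfolding basis_in_def
    proof (intro conjI allI impI)
      show "S \<union> J \<subseteq> LZ p" "indep (S \<union> J)" using SD(1,2) JZ H_iff[OF J] by auto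
      fix I assume I: "S \<union> J \<subseteq> I \<and> I \<subseteq> LZ p \<and> indep I"
      then have IJ: "(I - J) \<union> J = I" by blast
      have "H p (I - J)" unfolding H_iff[OF J] IJ using I by blast
      then have "I - J = S" using SD(3)[of "I - J"] I disj by blast
      then show "I = S \<union> J" using IJ by blast
    qed
    then show "S \<subseteq> LZ p \<and> basis_in indep (LZ p) (S \<union> J)" using SD(1) by blast
  }
  assume S: "S \<subseteq> LZ p \<and> basis_in indep (LZ p) (S \<union> J)"
  then have bSJ: "basis_in indep (LZ p) (S \<union> J)" by blast
  show "basis_in (H p) (LZ p) S"
    unfolding basis_in_def
  proof (intro conjI allI impI)
    show "H p S" unfolding H_iff[OF J] using S basis_inD(2)[OF bSJ] disj by blast
    fix I assume I: "S \<subseteq> I \<and> I \<subseteq> LZ p \<and> H p I"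
    then have "indep (I \<union> J)" "I \<inter> J = {}" using H_iff[OF J] by auto
    moreover have "I \<union> J = S \<union> J"
      using I JZ \<open>indep (I \<union> J)\<close> by (intro basis_inD(3)[OF bSJ]) auto
    ultimately show "I = S" using disj by blast
  qed (use S in blast)
qed

lemma mem_orbit_in_N_iff:
  assumes "C \<subseteq> E"
  shows "(e, p) \<in> orbit_in_N E indep Z B C \<longleftrightarrow> e \<in> C \<and> e \<in> LZ p - LB p"
proof -
  have NE: "(f, Z f) \<in> NE" if "f \<in> C" for f
    using assms that unfolding N_carrier_def level_def by auto
  show ?thesis
    unfolding orbit_in_N_def using assms by (auto simp: orbit_N_iff[OF NE] level_def)
qed

section \<open>Jordan bases and minimal bases\<close>

lemma jordan_basis_orbit_in_N:
  assumes CZ: "minimal_basis E indep Z C" and CB: "minimal_basis E indep B C"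
  shows "jordan_basis NE NI T (orbit_in_N E indep Z B C)"
proof -
  let ?J = "orbit_in_N E indep Z B C" and ?X = "(\<lambda>e. (e, Z e)) ` C"
  have CE: "C \<subseteq> E"
    using CZ basis_inD(1) unfolding minimal_basis_def by blast
  have NE: "(e, Z e) \<in> NE" if "e \<in> C" for e
    using CE that unfolding N_carrier_def level_def by auto
  have "basis_in (H p) (LZ p) (fibre ?J p)" for p
  proof -
    have fib: "fibre ?J p = C \<inter> (LZ p - LB p)" using mem_orbit_in_N_iff[OF CE] by auto
    have un: "C \<inter> (LZ p - LB p) \<union> C \<inter> LB p = C \<inter> LZ p" using level_B_subset by blast
    show ?thesis
      unfolding fib
      using basis_H_iff[OF level_basis_if_minimal_basis[OF CB], of "C \<inter> (LZ p - LB p)" p]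
        level_basis_if_minimal_basis[OF CZ, of p] un by auto
  qed
  moreover have "?J \<subseteq> NE"
    using mem_orbit_in_N_iff[OF CE] unfolding N_carrier_def by auto
  ultimately have "basis_in NI NE ?J" using basis_N_iff by blast
  moreover have "?X \<subseteq> NE" using NE by blast
  \<comment> \<open>Orbits preserve the first coordinate, which determines the starting point in
    \<open>?X\<close>.\<close>
  moreover have "disjoint_family_on (orbit NE NI T) ?X"
    unfolding disjoint_family_on_def by (auto simp: orbit_N_iff[OF NE])
  moreover have "?J = (\<Union>x\<in>?X. orbit NE NI T x)"
    unfolding orbit_in_N_def by simp
  ultimately show ?thesis unfolding jordan_basis_def by blast
qed

lemma ex_minimal_basis_of_jordan_basis:
  assumes "jordan_basis NE NI T J"
  obtains C where "minimal_basis E indep Z C" "minimal_basis E indep B C"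
    "J = orbit_in_N E indep Z B C"
proof -
  let ?S = "fibre J"
  obtain X where X: "X \<subseteq> NE" "J = (\<Union>x\<in>X. orbit NE NI T x)"
    and J: "basis_in NI NE J"
    using assms unfolding jordan_basis_def by blast
  have JN: "J \<subseteq> NE" and S: "basis_in (H p) (LZ p) (?S p)" for p
    using J[unfolded basis_N_iff] by simp_all
  have HS: "H p (?S p)" for p using basis_inD(2)[OF S] .
  \<comment> \<open>Orbits are closed under \<open>T\<close> up to loops, hence so is their union
    \<open>J\<close>.\<close>
  have shift: "(e, q) \<in> J" if e: "(e, p) \<in> J" "p \<le> q" "q < B e" for e p q
  proof -
    obtain x where x: "x \<in> X" "(e, p) \<in> orbit NE NI T x" using e(1) X(2) by blast
    obtain f r where fr: "x = (f, r)" by fastforce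
    have "(f, r) \<in> NE" using x X fr by blast
    then have "(e, q) \<in> orbit NE NI T x"
      using x e orbit_N_iff[of f r] unfolding fr by auto
    then show ?thesis using x X by blast
  qed
  \<comment> \<open>\<open>D\<close> is the basis reached at stage \<open>k\<close>. The second
    conjunct keeps its traces on earlier levels bases; the third records that it has absorbed the
    elements whose next copy is a loop.\<close>
  have "\<exists>D. basis_in indep (LB (int k)) D \<and>
      (\<forall>j\<le>k. basis_in indep (LB (int j)) (D \<inter> LB (int j))) \<and>
      (\<forall>j<k. ?S (int j) \<inter> LB (int j + 1) \<subseteq> D)" for k
  proof (induction k)
    case 0
    show ?case using LB_empty[of 0] indep_empty unfolding basis_in_def by auto
  next
    case (Suc k)
    then obtain D where D: "basis_in indep (LB (int k)) D"
      and Dj: "\<And>j. j \<le> k \<Longrightarrow> basis_in indep (LB (int j)) (D \<inter> LB (int j))"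
      and DS: "\<And>j. j < k \<Longrightarrow> ?S (int j) \<inter> LB (int j + 1) \<subseteq> D" by blast
    let ?I = "D \<union> (?S (int k) \<inter> LB (int k + 1))"
    have "indep (?S (int k) \<union> D)" using HS H_iff[OF D] by blast
    then have "indep ?I" by (rule indep_subset) auto
    moreover have "?I \<subseteq> LB (int k + 1)"
      using basis_inD(1)[OF D] LB_mono[of "int k" "int k + 1"] by auto
    ultimately obtain D' where D': "?I \<subseteq> D'" "basis_in indep (LB (int k + 1)) D'"
      by (rule indep_extend_basis)
    have "basis_in indep (LB (int j)) (D' \<inter> LB (int j))" if "j \<le> Suc k" for j
    proof (cases "j = Suc k")
      case True
      then show ?thesis
        using D'(2) basis_inD(1)[OF D'(2)] by (simp add: Int_absorb2 add.commute)
    next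
      case False
      then have bj: "basis_in indep (LB (int j)) (D \<inter> LB (int j))" using that Dj by simp
      \<comment> \<open>The left side is independent and contains a basis of
        \<open>LB (int j)\<close>, so nothing new appears on old levels.\<close>
      have "D' \<inter> LB (int j) = D \<inter> LB (int j)"
        using D'(1) indep_subset[OF basis_inD(2)[OF D'(2)]]
        by (intro basis_inD(3)[OF bj]) auto
      then show ?thesis using bj by simp
    qed
    moreover have "?S (int j) \<inter> LB (int j + 1) \<subseteq> D'" if "j < Suc k" for j
      using DS[of j] that D'(1) by (cases "j = k") auto
    ultimately show ?case using D'(2) by (intro exI[of _ D']) (auto simp: add.commute)
  qed
  from this[of m] obtain C where C: "basis_in indep E C"
    and Cj: "\<And>j. j \<le> m \<Longrightarrow> basis_in indep (LB (int j)) (C \<inter> LB (int j))"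
    and CS: "\<And>j. j < m \<Longrightarrow> ?S (int j) \<inter> LB (int j + 1) \<subseteq> C"
    using LB_eq_carrier[of "int m"] by auto
  note CD = basis_inD[OF C]
  have CB: "basis_in indep (LB p) (C \<inter> LB p)" for p
  proof -
    consider "p \<le> 0" | "int m \<le> p" | "0 \<le> p" "p \<le> int m" by linarith
    then show ?thesis
    proof cases
      case 1
      then show ?thesis using LB_empty indep_empty unfolding basis_in_def by auto
    next
      case 2
      then show ?thesis using LB_eq_carrier C CD(1) by (simp add: Int_absorb2)
    next
      case 3
      then show ?thesis using Cj[of "nat p"] by simp
    qed
  qed
  have SC: "?S p \<subseteq> C" for p
  proof
    fix e assume "e \<in> ?S p"
    then have e: "(e, p) \<in> J" by simp
    have eE: "e \<in> E" using e JN unfolding N_carrier_def level_def by auto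
    then have "1 \<le> B e" "B e \<le> int m" using B_range by force+
    have "e \<notin> LB p" using H_disjoint_LB[OF HS] e by blast
    then have "p < B e" using eE unfolding level_def by simp
    \<comment> \<open>Level \<open>B e - 1\<close> carries the last non-loop copy of
      \<open>e\<close>; the construction put such elements into \<open>C\<close>.\<close>
    then have "(e, B e - 1) \<in> J" using shift[OF e] by simp
    moreover have "nat (B e - 1) < m"
      using \<open>1 \<le> B e\<close> \<open>B e \<le> int m\<close> by linarith
    ultimately show "e \<in> C"
      using CS[of "nat (B e - 1)"] \<open>1 \<le> B e\<close> \<open>B e \<le> int m\<close> eE
      unfolding level_def by auto
  qed
  have CZ: "C \<inter> LZ p = ?S p \<union> C \<inter> LB p" "basis_in indep (LZ p) (C \<inter> LZ p)" for p
  proof -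
    have "?S p \<inter> (C \<inter> LB p) = {}" using H_disjoint_LB[OF HS] by blast
    then have SZ: "?S p \<subseteq> LZ p" and b: "basis_in indep (LZ p) (?S p \<union> C \<inter> LB p)"
      using basis_H_iff[OF CB] S by blast+
    \<comment> \<open>The right side is a basis of \<open>LZ p\<close> contained in the independent
      left side, so maximality gives equality.\<close>
    show *: "C \<inter> LZ p = ?S p \<union> C \<inter> LB p"
      using SZ SC[of p] level_B_subset[of p] indep_subset[OF CD(2), of "C \<inter> LZ p"]
      by (intro basis_inD(3)[OF b]) auto
    show "basis_in indep (LZ p) (C \<inter> LZ p)" unfolding * by (rule b)
  qed
  \<comment> \<open>As \<open>?S p\<close> avoids \<open>LB p\<close>, removing \<open>LB p\<close>
    from \<open>C \<inter> LZ p\<close> leaves exactly the fibre.\<close>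
  have "(e, p) \<in> J \<longleftrightarrow> (e, p) \<in> orbit_in_N E indep Z B C" for e p
    unfolding mem_orbit_in_N_iff[OF CD(1)]
    using CZ(1)[of p] H_disjoint_LB[OF HS, of p] by blast
  then have "J = orbit_in_N E indep Z B C" by auto
  with minimal_basis_if_level_basis[OF Z_range C CZ(2)]
    minimal_basis_if_level_basis[OF B_range C CB]
  show ?thesis by (rule that)
qed

end

theorem proposition5p2p5:
  fixes E :: "'a set" and indep :: "'a set \<Rightarrow> bool"
    and Z B :: "'a \<Rightarrow> int" and n m :: nat
  assumes "finite_rank_matroid E indep"
    and "closed_filtration E indep n Z"
    and "closed_filtration E indep m B"
    and "\<And>p. level E B p \<subseteq> level E Z p"
  shows "{J. jordan_basis (N_carrier E Z) (N_indep E indep Z B) T J} =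
         {orbit_in_N E indep Z B C | C. minimal_basis E indep Z C \<and> minimal_basis E indep B C}"
proof -
  interpret finite_rank_matroid E indep by fact
  interpret closed_filtration_pair E indep Z B n m
    by unfold_locales (use assms in auto)
  show ?thesis
  proof (intro set_eqI iffI)
    fix J assume "J \<in> {J. jordan_basis NE NI T J}"
    then have "jordan_basis NE NI T J" by simp
    then obtain C where "minimal_basis E indep Z C" "minimal_basis E indep B C"
      "J = orbit_in_N E indep Z B C"
      by (rule ex_minimal_basis_of_jordan_basis)
    then show "J \<in> {orbit_in_N E indep Z B C | C.
        minimal_basis E indep Z C \<and> minimal_basis E indep B C}" by blast
  qed (use jordan_basis_orbit_in_N in auto)
qed

end
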